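(* Let $n\ge 2$, let $\bm{M},\bm{K}\in\mathbb{R}^{n\times n}$ be symmetric matrices with $\bm{M}$ positive definite, and let $w_1\le w_2\le\dots\le w_n$ be the eigenvalues of $\bm{M}$, counted with multiplicity. Let $\lambda_{\min}$ be the smallest eigenvalue of the generalized eigenvalue problem $\bm{K}\bm{v}=\lambda\bm{M}\bm{v}$, let $\tilde{\bm{v}}\in\mathbb{R}^n$ be a corresponding mass-normalized right eigenvector, i.e. $\bm{K}\tilde{\bm{v}}=\lambda_{\min}\bm{M}\tilde{\bm{v}}$ and $\tilde{\bm{v}}^{\intercal}\bm{M}\tilde{\bm{v}}=1$, and let $\tilde{\bm{g}}=\bm{M}\tilde{\bm{v}}$ be the corresponding left eigenvector. Then for every $\bm{x}\in\mathbb{R}^n$ with $\|\bm{x}\|\neq 0$, and every $\alpha\in\mathbb{R}$ such that $|w_1-\alpha|<|w_2-\alpha|$, $$ w_1 \;\ge\; \alpha-\frac{\|\bm{x}\|\,\|\tilde{\bm{g}}-\alpha\tilde{\bm{v}}\|}{\langle \bm{x},\tilde{\bm{v}}\rangle}. $$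
   Context: $\langle\cdot,\cdot\rangle$ and $\|\cdot\|$ denote the Euclidean inner product and norm on $\mathbb{R}^n$. $\bm{M}$ is the mass matrix and $\bm{K}$ the stiffness matrix of the linear elastic system $\bm{M}\ddot{\bm{y}}+\bm{K}\bm{y}=\bm{0}$ with state vector $\bm{y}$. A right eigenvector for $\lambda$ is a nonzero $\bm{v}$ with $\bm{M}^{-1}\bm{K}\bm{v}=\lambda\bm{v}$; a left eigenvector for $\lambda$ is a nonzero $\bm{g}$ with $\bm{g}^{\intercal}\bm{M}^{-1}\bm{K}=\lambda\bm{g}^{\intercal}$. The left eigenvector is scaled relative to the right one by the convention $\bm{g}=\bm{M}\bm{v}$.
   Formalization: The inequality is proved for x with ⟨x,ṽ⟩ > 0; as printed, for every x with ‖x‖ ≠ 0, the right-hand side is undefined when ⟨x,ṽ⟩ = 0 and the claim fails when ⟨x,ṽ⟩ < 0 (e.g. M=diag(1,2), K=diag(1,4), ṽ=e₁, x=−e₁, α=1.2). *)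

theory Defs
  imports "HOL-Analysis.Analysis" "HOL-Computational_Algebra.Polynomial"
begin

definition symmetric_matrix :: "'a^'n^'n \<Rightarrow> bool"
  where "symmetric_matrix A \<longleftrightarrow> transpose A = A"

definition pos_def_matrix :: "real^'n^'n \<Rightarrow> bool"
  where "pos_def_matrix A \<longleftrightarrow> (\<forall>x. x \<noteq> 0 \<longrightarrow> x \<bullet> (A *v x) > 0)"

text \<open>The characteristic polynomial \<open>det (X I - A)\<close>, as a determinant over the polynomial ring.\<close>

definition charpoly :: "'a::comm_ring_1^'n^'n \<Rightarrow> 'a poly"
  where "charpoly A = det (mat [:0, 1:] - map_matrix (\<lambda>a. [:a:]) A)"

text \<open>
  \<open>w 1 \<le> \<dots> \<le> w n\<close> list the eigenvalues of \<open>A\<close> in increasing order, each repeated according to its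
  multiplicity as a root of the characteristic polynomial. Since \<open>proots\<close> only collects the real
  roots, the condition includes that the characteristic polynomial splits over the reals; for
  symmetric \<open>A\<close> this is always the case.
\<close>

definition sorted_eigenvalues :: "real^'n^'n \<Rightarrow> (nat \<Rightarrow> real) \<Rightarrow> bool"
  where "sorted_eigenvalues A w \<longleftrightarrow>
    mono_on {1..CARD('n)} w \<and> proots (charpoly A) = image_mset w (mset_set {1..CARD('n)})"

definition gen_eigenvector :: "real^'n^'n \<Rightarrow> real^'n^'n \<Rightarrow> real \<Rightarrow> real^'n \<Rightarrow> bool"
  where "gen_eigenvector K M l v \<longleftrightarrow> v \<noteq> 0 \<and> K *v v = l *\<^sub>R (M *v v)"

definition gen_eigenvalue :: "real^'n^'n \<Rightarrow> real^'n^'n \<Rightarrow> real \<Rightarrow> bool"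
  where "gen_eigenvalue K M l \<longleftrightarrow> (\<exists>v. gen_eigenvector K M l v)"

definition smallest_gen_eigenvalue :: "real^'n^'n \<Rightarrow> real^'n^'n \<Rightarrow> real \<Rightarrow> bool"
  where "smallest_gen_eigenvalue K M l \<longleftrightarrow>
    gen_eigenvalue K M l \<and> (\<forall>\<mu>. gen_eigenvalue K M \<mu> \<longrightarrow> l \<le> \<mu>)"

lemma poly_charpoly: "poly (charpoly A) t = det (mat t - A)"
  by (auto simp: charpoly_def det_def poly_sum poly_prod mat_def if_distrib[of "\<lambda>p. poly p t"]
      intro!: sum.cong prod.cong cong: if_cong)

lemma charpoly_root_iff:
  fixes A :: "real^'n^'n"
  shows "poly (charpoly A) t = 0 \<longleftrightarrow> (\<exists>v. v \<noteq> 0 \<and> A *v v = t *\<^sub>R v)"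
proof -
  have *: "(mat t - A) *v v = t *\<^sub>R v - A *v v" for v :: "real^'n"
  proof -
    have "mat t *v v = t *\<^sub>R v"
      by (simp add: vec_eq_iff matrix_vector_mult_def mat_def if_distrib if_distribR cong: if_cong)
    then show ?thesis by (simp add: matrix_vector_mult_diff_rdistrib)
  qed
  have "det (mat t - A) = 0 \<longleftrightarrow> \<not> (\<exists>B. B ** (mat t - A) = mat 1)"
    by (metis invertible_det_nz invertible_left_inverse)
  then show ?thesis
    unfolding poly_charpoly matrix_left_invertible_ker * by auto
qed

end

theory Submission
  imports Defs
begin

text \<open>
  By Cauchy-Schwarz, \<open>\<langle>x, v\<rangle> \<le> \<parallel>x\<parallel> \<parallel>v\<parallel>\<close>, so the subtracted quotient is at least
  \<open>\<parallel>M v - \<alpha> v\<parallel> / \<parallel>v\<parallel>\<close>. For a symmetric matrix, the relative residual of any nonzero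
  vector bounds from above the distance from \<open>\<alpha>\<close> to the nearest eigenvalue
  (\<open>symmetric_matrix_eigenvalue_near\<close>). The condition \<open>\<bar>w 1 - \<alpha>\<bar> < \<bar>w 2 - \<alpha>\<bar>\<close> puts \<open>\<alpha>\<close> to the left
  of the midpoint of \<open>w 1\<close> and \<open>w 2\<close>, which makes \<open>w 1\<close> that nearest eigenvalue
  (\<open>first_nearest\<close>). Hence \<open>\<alpha> - w 1 \<le> \<bar>w 1 - \<alpha>\<bar>\<close> is at most the quotient.

  The residual bound is obtained without diagonalising. For a self-adjoint map \<open>f\<close>, a
  minimiser \<open>u\<close> of \<open>\<parallel>f u\<parallel>\<close> on the unit sphere, with minimum \<open>s\<close>, is an eigenvector of \<open>f \<circ> f\<close>
  for \<open>s\<^sup>2\<close>; the factorisation \<open>f\<^sup>2 - s\<^sup>2 = (f - s) (f + s)\<close> then shows that \<open>s\<close> or \<open>-s\<close> is an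
  eigenvalue of \<open>f\<close>. It is applied to \<open>f = M - \<alpha>\<close>.
\<close>

lemma linear_coeff_zero_if_quadratic_nonneg:
  fixes b c :: real
  assumes "\<And>t. 0 \<le> 2 * t * b + t\<^sup>2 * c"
  shows "b = 0"
proof (rule ccontr)
  assume "b \<noteq> 0"
  define d where "d = \<bar>c\<bar> + 1"
  have "d > 0" "c < 2 * d" by (auto simp: d_def)
  have "2 * (- b / d) * b + (- b / d)\<^sup>2 * c = (b / d)\<^sup>2 * (c - 2 * d)"
    using \<open>d > 0\<close> by (simp add: field_simps power2_eq_square)
  also have "\<dots> < 0"
    using \<open>d > 0\<close> \<open>b \<noteq> 0\<close> \<open>c < 2 * d\<close> by (intro mult_pos_neg) auto
  finally show False using assms[of "- b / d"] by linarith
qed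

text \<open>
  First variation: the form \<open>\<parallel>f y\<parallel>\<^sup>2 - s\<^sup>2 \<parallel>y\<parallel>\<^sup>2\<close> is nonnegative and vanishes at \<open>u\<close>, so its
  derivative \<open>2 \<langle>f (f u) - s\<^sup>2 u, z\<rangle>\<close> at \<open>u\<close> vanishes in every direction \<open>z\<close>.
\<close>

lemma self_adjoint_minimiser_eigenvector_square:
  fixes f :: "'a::real_inner \<Rightarrow> 'a"
  assumes lin: "linear f" and adj: "\<And>x y. f x \<bullet> y = x \<bullet> f y"
    and min: "\<And>y. s * norm y \<le> norm (f y)" and "0 \<le> s" and u: "norm (f u) = s * norm u"
  shows "f (f u) = s\<^sup>2 *\<^sub>R u"
proof -
  define z where "z = f (f u) - s\<^sup>2 *\<^sub>R u"
  have nonneg: "0 \<le> f y \<bullet> f y - s\<^sup>2 * (y \<bullet> y)" for y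
  proof -
    have "(s * norm y)\<^sup>2 \<le> (norm (f y))\<^sup>2"
      using min[of y] \<open>0 \<le> s\<close> by (intro power_mono) auto
    then show ?thesis by (simp add: power_mult_distrib power2_norm_eq_inner)
  qed
  have zero: "f u \<bullet> f u = s\<^sup>2 * (u \<bullet> u)"
    using u by (metis power_mult_distrib power2_norm_eq_inner)
  have "0 \<le> 2 * t * (z \<bullet> z) + t\<^sup>2 * (f z \<bullet> f z - s\<^sup>2 * (z \<bullet> z))" for t
  proof -
    have "z \<bullet> z = (f (f u) - s\<^sup>2 *\<^sub>R u) \<bullet> z"
      by (simp only: z_def)
    then have zz: "z \<bullet> z = f u \<bullet> f z - s\<^sup>2 * (u \<bullet> z)"
      using adj[of "f u" z] by (simp add: inner_diff_left)
    have "f (u + t *\<^sub>R z) = f u + t *\<^sub>R f z"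
      using lin by (simp add: linear_add linear_cmul)
    then have "f (u + t *\<^sub>R z) \<bullet> f (u + t *\<^sub>R z) - s\<^sup>2 * ((u + t *\<^sub>R z) \<bullet> (u + t *\<^sub>R z))
        = 2 * t * (f u \<bullet> f z - s\<^sup>2 * (u \<bullet> z)) + t\<^sup>2 * (f z \<bullet> f z - s\<^sup>2 * (z \<bullet> z))"
      using zero
      by (simp add: inner_add_left inner_add_right inner_commute algebra_simps power2_eq_square)
    then show ?thesis using nonneg[of "u + t *\<^sub>R z"] zz by simp
  qed
  then have "z \<bullet> z = 0" by (rule linear_coeff_zero_if_quadratic_nonneg)
  then show ?thesis by (simp add: z_def)
qed

text \<open>
  The minimum \<open>s\<close> of \<open>\<parallel>f y\<parallel>\<close> on the unit sphere is attained at some \<open>u\<close>, and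
  \<open>(f - s) (f u + s u) = 0\<close>. So either \<open>f u + s u\<close> is an eigenvector for \<open>s\<close>, or it vanishes
  and \<open>u\<close> is one for \<open>-s\<close>.
\<close>

lemma self_adjoint_eigenvalue_least_modulus:
  fixes f :: "'a::euclidean_space \<Rightarrow> 'a"
  assumes lin: "linear f" and adj: "\<And>x y. f x \<bullet> y = x \<bullet> f y"
  obtains \<mu> h where "h \<noteq> 0" and "f h = \<mu> *\<^sub>R h" and "\<And>y. \<bar>\<mu>\<bar> * norm y \<le> norm (f y)"
proof -
  have "continuous_on (sphere 0 1) (\<lambda>y. norm (f y))"
    using lin by (intro continuous_intros linear_continuous_on) (simp add: linear_linear)
  moreover have "sphere (0::'a) 1 \<noteq> {}"
    by simp
  ultimately obtain u where u: "norm u = 1"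
    and le: "\<And>y. norm y = 1 \<Longrightarrow> norm (f u) \<le> norm (f y)"
    using continuous_attains_inf[of "sphere (0::'a) 1" "\<lambda>y. norm (f y)"] by auto
  define s where "s = norm (f u)"
  have min: "s * norm y \<le> norm (f y)" for y
  proof (cases "y = 0")
    case False
    then have "s \<le> norm (f ((1 / norm y) *\<^sub>R y))"
      unfolding s_def by (intro le) simp
    then show ?thesis
      using False lin by (simp add: linear_cmul field_simps)
  qed (use lin in \<open>simp add: linear_0\<close>)
  have sq: "f (f u) = s\<^sup>2 *\<^sub>R u"
    using lin adj min by (rule self_adjoint_minimiser_eigenvector_square) (auto simp: s_def u)
  show ?thesis
  proof (cases "f u + s *\<^sub>R u = 0")
    case True
    then have "f u = (- s) *\<^sub>R u" by (simp add: eq_neg_iff_add_eq_0)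
    then show ?thesis
      using u min by (intro that[of u "- s"]) (auto simp: s_def)
  next
    case False
    have "f (f u + s *\<^sub>R u) = s *\<^sub>R (f u + s *\<^sub>R u)"
      using lin sq by (simp add: linear_add linear_cmul algebra_simps power2_eq_square)
    then show ?thesis
      using False min by (intro that[of "f u + s *\<^sub>R u" s]) (auto simp: s_def)
  qed
qed

lemma symmetric_matrix_eigenvalue_near:
  fixes A :: "real^'n^'n"
  assumes "symmetric_matrix A"
  obtains l h where "h \<noteq> 0" and "A *v h = l *\<^sub>R h"
    and "\<And>y. \<bar>l - \<alpha>\<bar> * norm y \<le> norm (A *v y - \<alpha> *\<^sub>R y)"
proof -
  let ?f = "\<lambda>y. A *v y - \<alpha> *\<^sub>R y"
  have "linear ?f"
    by (intro linear_compose_sub matrix_vector_mul_linear linear_scaleR)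
  moreover have "?f x \<bullet> y = x \<bullet> ?f y" for x y
    using assms
    by (simp add: symmetric_matrix_def inner_diff_left inner_diff_right dot_lmul_matrix[symmetric]
        flip: transpose_matrix_vector)
  ultimately obtain \<mu> h where "h \<noteq> 0" and h: "?f h = \<mu> *\<^sub>R h"
    and \<mu>: "\<And>y. \<bar>\<mu>\<bar> * norm y \<le> norm (?f y)"
    by (rule self_adjoint_eigenvalue_least_modulus) auto
  have "A *v h = (\<mu> + \<alpha>) *\<^sub>R h"
    using h by (simp add: scaleR_add_left diff_eq_eq)
  with \<open>h \<noteq> 0\<close> \<mu> show ?thesis
    by (intro that[of h "\<mu> + \<alpha>"]) auto
qed

lemma sorted_eigenvalues_eigenvalueE:
  fixes A :: "real^'n^'n"
  assumes "sorted_eigenvalues A w" and "h \<noteq> 0" and "A *v h = l *\<^sub>R h"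
  obtains i where "i \<in> {1..CARD('n)}" and "l = w i"
proof -
  have proots: "proots (charpoly A) = image_mset w (mset_set {1..CARD('n)})"
    using assms(1) by (simp add: sorted_eigenvalues_def)
  \<comment> \<open>The zero polynomial has the empty multiset of roots, whereas \<open>w\<close> lists \<open>n \<ge> 1\<close> of them.\<close>
  have "size (proots (charpoly A)) \<noteq> 0"
    unfolding proots by simp
  then have "charpoly A \<noteq> 0"
    by auto
  moreover have "poly (charpoly A) l = 0"
    using assms(2,3) charpoly_root_iff by blast
  ultimately have "l \<in># proots (charpoly A)"
    by simp
  then show ?thesis
    using that unfolding proots by auto
qed

lemma first_nearest:
  fixes w :: "nat \<Rightarrow> real"
  assumes mono: "mono_on {1..n} w" and near: "\<bar>w 1 - \<alpha>\<bar> < \<bar>w 2 - \<alpha>\<bar>" and i: "i \<in> {1..n}"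
  shows "\<bar>w 1 - \<alpha>\<bar> \<le> \<bar>w i - \<alpha>\<bar>"
proof (cases "i = 1")
  case False
  then have "w 1 \<le> w 2" "w 2 \<le> w i"
    using i by (auto intro!: mono_onD[OF mono])
  then show ?thesis using near by linarith
qed simp

theorem theorem2:
  fixes M K :: "real^'n^'n"
    and w :: "nat \<Rightarrow> real"
    and lmin \<alpha> :: real
    and v g x :: "real^'n"
  assumes "CARD('n) \<ge> 2"
    and "symmetric_matrix M" and "symmetric_matrix K" and "pos_def_matrix M"
    and "sorted_eigenvalues M w"
    and "smallest_gen_eigenvalue K M lmin"
    and "gen_eigenvector K M lmin v" and "v \<bullet> (M *v v) = 1"
    and "g = M *v v"
    and "norm x \<noteq> 0" and "x \<bullet> v > 0"
    and "\<bar>w 1 - \<alpha>\<bar> < \<bar>w 2 - \<alpha>\<bar>"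
  shows "w 1 \<ge> \<alpha> - norm x * norm (g - \<alpha> *\<^sub>R v) / (x \<bullet> v)"
proof -
  obtain l h where "h \<noteq> 0" and "M *v h = l *\<^sub>R h"
    and near: "\<And>y. \<bar>l - \<alpha>\<bar> * norm y \<le> norm (M *v y - \<alpha> *\<^sub>R y)"
    using symmetric_matrix_eigenvalue_near[OF \<open>symmetric_matrix M\<close>] by blast
  then obtain i where i: "i \<in> {1..CARD('n)}" and "l = w i"
    using sorted_eigenvalues_eigenvalueE[OF \<open>sorted_eigenvalues M w\<close>] by blast
  then have first: "\<bar>w 1 - \<alpha>\<bar> \<le> \<bar>l - \<alpha>\<bar>"
    using first_nearest[of "CARD('n)" w \<alpha> i] assms(5,12) by (simp add: sorted_eigenvalues_def)
  have "(\<alpha> - w 1) * (x \<bullet> v) \<le> \<bar>l - \<alpha>\<bar> * (norm x * norm v)"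
    using first \<open>x \<bullet> v > 0\<close> norm_cauchy_schwarz[of x v] by (intro mult_mono) auto
  also have "\<dots> \<le> norm x * norm (g - \<alpha> *\<^sub>R v)"
    using mult_left_mono[OF near[of v], of "norm x"] by (simp add: \<open>g = M *v v\<close> mult_ac)
  finally have "\<alpha> - w 1 \<le> norm x * norm (g - \<alpha> *\<^sub>R v) / (x \<bullet> v)"
    using \<open>x \<bullet> v > 0\<close> by (simp add: pos_le_divide_eq)
  then show ?thesis by simp
qed

end
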